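(* Let $n,m\ge1$ be integers with $(n,m)\neq(1,1)$. The polytopes $\mathsf P_{n,m}$ and $\mathsf Q_{n,m}$ (once- and twice-truncated graphical zonotopes of the complete bipartite graph $K_{n,m}$) are deformed permutahedra.
   Context: Let $K_{n,m}$ be the complete bipartite graph with nodes $a_1,\dots,a_n,b_1,\dots,b_m$ and arcs $a_ib_j$. Let $\mathbb R^{n+m}$ have coordinates and standard basis vectors labeled by these nodes. Its graphical zonotope is the Minkowski sum of segments $\mathsf Z_{n,m}=\sum_{i=1}^n\sum_{j=1}^m[e_{a_i},e_{b_j}]\subset\mathbb R^{n+m}$. Define $$\mathsf P_{n,m}=\mathsf Z_{n,m}\cap\Big\{x:\sum_{j=1}^m x_{b_j}\le nm-1\Big\},\qquad \mathsf Q_{n,m}=\mathsf P_{n,m}\cap\Big\{x:\sum_{i=1}^n x_{a_i}\le nm-1\Big\}.$$ A polytope $\mathsf Q$ is a deformation of a polytope $\mathsf P$ if $\lambda\mathsf P=\mathsf Q+\mathsf R$ for some $\lambda>0$ and some polytope $\mathsf R$. The $N$-permutahedron is the convex hull of the permutations of $(1,\dots,N)$ in $\mathbb R^N$. A deformed ($N$-)permutahedron is a deformation of the $N$-permutahedron, equivalently a polytope in $\mathbb R^N$ all of whose edges are parallel to $e_i-e_j$ for some $i,j$ (here $N=n+m$). *)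

theory Defs
  imports "HOL-Analysis.Analysis"
begin

text \<open>
  The node set of the complete bipartite graph is the sum type of two finite types
  \<open>'n\<close> and \<open>'m\<close>: the node \<open>a\<^sub>i\<close> is \<open>Inl i\<close> and the node \<open>b\<^sub>j\<close> is \<open>Inr j\<close>, with
  \<open>n = CARD('n)\<close> and \<open>m = CARD('m)\<close>, both at least 1 since types are inhabited.
  Addition and summation of sets are Minkowski sums (\<^theory>\<open>HOL-Library.Set_Algebras\<close>).
\<close>

definition bipartite_zonotope :: "(real ^ ('n::finite + 'm::finite)) set" where
  "bipartite_zonotope =
    (\<Sum>i\<in>UNIV. \<Sum>j\<in>UNIV. closed_segment (axis (Inl i) 1) (axis (Inr j) 1))"

definition truncated_zonotope :: "(real ^ ('n::finite + 'm::finite)) set" where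
  "truncated_zonotope =
    bipartite_zonotope \<inter>
      {x. (\<Sum>j\<in>UNIV. x $ Inr j) \<le> real CARD('n) * real CARD('m) - 1}"

definition twice_truncated_zonotope :: "(real ^ ('n::finite + 'm::finite)) set" where
  "twice_truncated_zonotope =
    truncated_zonotope \<inter>
      {x. (\<Sum>i\<in>UNIV. x $ Inl i) \<le> real CARD('n) * real CARD('m) - 1}"

text \<open>
  The library's polytopes include the empty set; \<open>R \<noteq> {}\<close> keeps the definition
  from degenerating for empty \<open>P\<close> and is automatic when \<open>P\<close> is nonempty.
\<close>

definition deformation_of :: "'a::euclidean_space set \<Rightarrow> 'a set \<Rightarrow> bool" where
  "deformation_of Q P \<longleftrightarrow>
    polytope Q \<and> polytope P \<and>
    (\<exists>l>0. \<exists>R. polytope R \<and> R \<noteq> {} \<and> (\<lambda>x. l *\<^sub>R x) ` P = Q + R)"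

text \<open>
  A vector is a permutation of \<open>(1, \<dots>, N)\<close> iff its coordinates take each of the values
  \<open>1, \<dots>, N\<close> exactly once; this needs no ordering of the index type.
\<close>

definition permutahedron :: "(real ^ 'k::finite) set" where
  "permutahedron =
    convex hull {x. bij_betw (\<lambda>i. x $ i) UNIV (real ` {1..CARD('k)})}"

definition deformed_permutahedron :: "(real ^ 'k::finite) set \<Rightarrow> bool" where
  "deformed_permutahedron Q \<longleftrightarrow> deformation_of Q permutahedron"

end

(* A base polytope of a submodular function f is the convex hull of its greedy vertices, which are
   additive in f; hence base polytopes add up as their functions do. The permutahedron belongs to
   p(S) = |S| (2 N + 1 - |S|) / 2, whose submodularity is strict on incomparable sets, so l p - f
   is submodular for large l and every base polytope is a deformed permutahedron. The zonotope is
   the base polytope of the function z counting the arcs that meet S. The truncations lower z by 1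
   at the node sets B and A, and z has enough slack there to remain submodular. *)

theory Submission
  imports Defs
begin

section \<open>Submodular functions and their greedy vertices\<close>

definition submodular :: "('k set \<Rightarrow> real) \<Rightarrow> bool" where
  "submodular f \<longleftrightarrow> (\<forall>S T. f (S \<union> T) + f (S \<inter> T) \<le> f S + f T)"

definition base_polytope :: "('k::finite set \<Rightarrow> real) \<Rightarrow> (real ^ 'k) set" where
  "base_polytope f =
    {x. (\<Sum>i\<in>UNIV. x $ i) = f UNIV \<and> (\<forall>S. (\<Sum>i\<in>S. x $ i) \<le> f S)}"

text \<open>Besides generating the permutahedron, these vectors encode the total orders of the
  indices: distinct entries rank the indices without any order on the type
  \<open>'k\<close>.\<close>

definition permutation_vectors :: "(real ^ 'k::finite) set" where
  "permutation_vectors = {x. bij_betw (\<lambda>i. x $ i) UNIV (real ` {1..CARD('k)})}"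

text \<open>The greedy algorithm treats the indices in decreasing order of the entries of \<open>r\<close>.\<close>

definition greedy :: "('k::finite set \<Rightarrow> real) \<Rightarrow> real ^ 'k \<Rightarrow> real ^ 'k" where
  "greedy f r = (\<chi> i. f {j. r $ i \<le> r $ j} - f {j. r $ i < r $ j})"

lemma submodularD: "submodular f \<Longrightarrow> f (S \<union> T) + f (S \<inter> T) \<le> f S + f T"
  by (simp add: submodular_def)

lemma inj_permutation_vector: "r \<in> permutation_vectors \<Longrightarrow> inj (\<lambda>i. r $ i)"
  by (simp add: permutation_vectors_def bij_betw_def)

lemma obtain_minimal_entry:
  fixes r :: "real ^ 'k::finite"
  assumes "inj (\<lambda>i. r $ i)" "T \<noteq> {}"
  obtains i where "i \<in> T" "\<And>j. j \<in> T - {i} \<Longrightarrow> r $ i < r $ j"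
proof -
  have "finite T" by simp
  then obtain i where i: "i \<in> T" "\<And>j. j \<in> T \<Longrightarrow> r $ i \<le> r $ j"
    using assms(2) arg_min_if_finite(1) [of T "\<lambda>i. r $ i"] arg_min_least [of T _ "\<lambda>i. r $ i"]
    by blast
  have "r $ i < r $ j" if "j \<in> T - {i}" for j
    using i(2) [of j] that injD [OF assms(1), of i j] by force
  with i(1) that show thesis by blast
qed

lemma upper_set_split:
  fixes r :: "real ^ 'k::finite"
  assumes "inj (\<lambda>i. r $ i)"
  shows "{j. r $ i \<le> r $ j} = insert i {j. r $ i < r $ j}"
  using injD [OF assms] by (auto simp: order_le_less)

text \<open>Diminishing returns: if \<open>i\<close> has the least entry in \<open>T\<close>, then
  the rest of \<open>T\<close> lies strictly above \<open>i\<close>. Adding \<open>i\<close> to the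
  larger set \<open>?U\<close> gains at most what adding it to \<open>T - {i}\<close> gains, and the
  gains telescope over \<open>T\<close>.\<close>

lemma sum_greedy_le:
  fixes f :: "'k::finite set \<Rightarrow> real"
  assumes f: "submodular f" "f {} = 0" and r: "inj (\<lambda>i. r $ i)"
  shows "(\<Sum>i\<in>T. greedy f r $ i) \<le> f T"
proof (induction "card T" arbitrary: T)
  case 0
  then show ?case using f by simp
next
  case (Suc k)
  then have "T \<noteq> {}" by auto
  from obtain_minimal_entry [OF r this]
  obtain i where i: "i \<in> T" "\<And>j. j \<in> T - {i} \<Longrightarrow> r $ i < r $ j" by blast
  let ?U = "{j. r $ i < r $ j}"
  have "T \<union> ?U = insert i ?U" "T \<inter> ?U = T - {i}" using i by auto
  then have "f (insert i ?U) + f (T - {i}) \<le> f T + f ?U"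
    using submodularD [OF f(1), of T ?U] by simp
  then have "greedy f r $ i \<le> f T - f (T - {i})"
    by (simp add: greedy_def upper_set_split [OF r])
  moreover have "(\<Sum>i\<in>T - {i}. greedy f r $ i) \<le> f (T - {i})"
    using Suc i(1) by simp
  moreover have "(\<Sum>i\<in>T. greedy f r $ i) = greedy f r $ i + (\<Sum>i\<in>T - {i}. greedy f r $ i)"
    by (rule sum.remove [OF finite i(1)])
  ultimately show ?case by linarith
qed

text \<open>For an upper set, \<open>T - {i}\<close> is all of the strict upper set of its minimum
  \<open>i\<close>, so the greedy increments telescope exactly and the constraint at
  \<open>T\<close> is tight.\<close>

lemma sum_greedy_upper_set:
  fixes f :: "'k::finite set \<Rightarrow> real"
  assumes f: "f {} = 0" and r: "inj (\<lambda>i. r $ i)"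
    and "\<And>i j. i \<in> T \<Longrightarrow> r $ i < r $ j \<Longrightarrow> j \<in> T"
  shows "(\<Sum>i\<in>T. greedy f r $ i) = f T"
  using assms(3)
proof (induction "card T" arbitrary: T)
  case 0
  then show ?case using f by simp
next
  case (Suc k)
  then have "T \<noteq> {}" by auto
  from obtain_minimal_entry [OF r this]
  obtain i where i: "i \<in> T" "\<And>j. j \<in> T - {i} \<Longrightarrow> r $ i < r $ j" by blast
  have "j \<in> T - {i}" if "r $ i < r $ j" for j
    using that Suc.prems(1) [OF i(1) that] by auto
  then have T: "T - {i} = {j. r $ i < r $ j}" using i(2) by blast
  have "(\<Sum>i\<in>T - {i}. greedy f r $ i) = f (T - {i})"
  proof (rule Suc.hyps(1))
    show "k = card (T - {i})" using Suc.hyps(2) i(1) by simp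
  qed (auto simp: T)
  moreover have "(\<Sum>i\<in>T. greedy f r $ i) = greedy f r $ i + (\<Sum>i\<in>T - {i}. greedy f r $ i)"
    by (rule sum.remove [OF finite i(1)])
  moreover have "greedy f r $ i = f T - f (T - {i})"
    using i(1) by (simp add: greedy_def upper_set_split [OF r] flip: T) (simp add: insert_absorb)
  ultimately show ?case by simp
qed

lemma greedy_in_base_polytope:
  assumes "submodular f" "f {} = 0" "inj (\<lambda>i. r $ i)"
  shows "greedy f r \<in> base_polytope f"
  using sum_greedy_le [OF assms] sum_greedy_upper_set [of f r UNIV] assms(2,3)
  by (simp add: base_polytope_def)

section \<open>Greedy vectors maximize linear functionals\<close>

text \<open>Summation by parts: on \<open>T\<close>, \<open>c\<close> is \<open>a\<close> plus a
  nonnegative combination of indicators of upper sets, on which \<open>w\<close> sums to a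
  nonnegative number. Keeping the level \<open>a\<close> variable makes the induction
  possible.\<close>

lemma abel_lower_bound:
  fixes c r w :: "real ^ 'k::finite"
  assumes r: "inj (\<lambda>i. r $ i)" and cr: "\<And>i j. r $ i < r $ j \<Longrightarrow> c $ i \<le> c $ j"
    and w: "\<And>U. (\<And>i j. i \<in> U \<Longrightarrow> r $ i < r $ j \<Longrightarrow> j \<in> U) \<Longrightarrow> 0 \<le> (\<Sum>i\<in>U. w $ i)"
    and "\<And>i j. i \<in> T \<Longrightarrow> r $ i < r $ j \<Longrightarrow> j \<in> T"
    and "\<And>i. i \<in> T \<Longrightarrow> a \<le> c $ i"
  shows "a * (\<Sum>i\<in>T. w $ i) \<le> (\<Sum>i\<in>T. c $ i * w $ i)"
  using assms(4,5)
proof (induction "card T" arbitrary: T a)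
  case 0
  then show ?case by simp
next
  case (Suc k)
  then have "T \<noteq> {}" by auto
  from obtain_minimal_entry [OF r this]
  obtain i where i: "i \<in> T" "\<And>j. j \<in> T - {i} \<Longrightarrow> r $ i < r $ j" by blast
  have "j \<in> T - {i}" if "r $ i < r $ j" for j
    using that Suc.prems(1) [OF i(1) that] by auto
  then have T: "T - {i} = {j. r $ i < r $ j}" using i(2) by blast
  \<comment> \<open>The level rises from \<open>a\<close> to \<open>c $ i\<close>, which bounds
    \<open>c\<close> from below on \<open>T - {i}\<close> because these indices lie above
    \<open>i\<close>.\<close>
  have "c $ i * (\<Sum>i\<in>T - {i}. w $ i) \<le> (\<Sum>i\<in>T - {i}. c $ i * w $ i)"
  proof (rule Suc.hyps(1))
    show "k = card (T - {i})" using Suc.hyps(2) i(1) by simp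
  qed (auto simp: T cr)
  moreover have "(\<Sum>i\<in>T. w $ i) = w $ i + (\<Sum>i\<in>T - {i}. w $ i)"
    "(\<Sum>i\<in>T. c $ i * w $ i) = c $ i * w $ i + (\<Sum>i\<in>T - {i}. c $ i * w $ i)"
    by (rule sum.remove [OF finite i(1)])+
  ultimately have "c $ i * (\<Sum>i\<in>T. w $ i) \<le> (\<Sum>i\<in>T. c $ i * w $ i)"
    by (simp add: algebra_simps)
  moreover have "a * (\<Sum>i\<in>T. w $ i) \<le> c $ i * (\<Sum>i\<in>T. w $ i)"
    by (intro mult_right_mono w) (use Suc.prems i(1) in blast)+
  ultimately show ?case by linarith
qed

text \<open>On upper sets of \<open>r\<close> the greedy vector attains the bound \<open>f\<close>,
  which \<open>x\<close> cannot exceed. Hence the difference \<open>?w\<close> satisfies the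
  hypothesis of \<open>abel_lower_bound\<close>.\<close>

lemma inner_le_greedy:
  fixes c r :: "real ^ 'k::finite"
  assumes f: "f {} = 0" and r: "inj (\<lambda>i. r $ i)"
    and cr: "\<And>i j. r $ i < r $ j \<Longrightarrow> c $ i \<le> c $ j"
    and x: "x \<in> base_polytope f"
  shows "c \<bullet> x \<le> c \<bullet> greedy f r"
proof -
  let ?w = "greedy f r - x"
  have w: "0 \<le> (\<Sum>i\<in>U. ?w $ i)" if "\<And>i j. i \<in> U \<Longrightarrow> r $ i < r $ j \<Longrightarrow> j \<in> U" for U
    using sum_greedy_upper_set [of f r U] f r that x
    by (simp add: sum_subtractf base_polytope_def)
  have "(\<Sum>i\<in>UNIV. ?w $ i) = 0"
    using sum_greedy_upper_set [of f r UNIV] f r x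
    by (simp add: sum_subtractf base_polytope_def)
  \<comment> \<open>Any lower bound on the entries of \<open>c\<close> would do, since it multiplies
    a total of zero.\<close>
  moreover have "Min (range (($) c)) * (\<Sum>i\<in>UNIV. ?w $ i) \<le> (\<Sum>i\<in>UNIV. c $ i * ?w $ i)"
    by (rule abel_lower_bound [where r = r]) (use r cr w in auto)
  ultimately have "0 \<le> c \<bullet> ?w" by (simp add: inner_vec_def)
  then show ?thesis by (simp add: inner_diff_right)
qed

text \<open>The vector \<open>r\<close> records the positions of the indices in a list sorted by
  \<open>c\<close>. Ties in \<open>c\<close> are broken arbitrarily, hence the weak inequality in
  the conclusion.\<close>

lemma obtain_sorting_permutation:
  fixes c :: "real ^ 'k::finite"
  obtains r where "r \<in> permutation_vectors" "\<And>i j. r $ i < r $ j \<Longrightarrow> c $ i \<le> c $ j"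
proof -
  obtain xs :: "'k list" where xs: "set xs = UNIV" "distinct xs"
    using finite_distinct_list [of "UNIV :: 'k set"] by auto
  define ys where "ys = sort_key (($) c) xs"
  have ys: "set ys = UNIV" "distinct ys" "sorted (map (($) c) ys)"
    using xs by (auto simp: ys_def)
  then have len: "length ys = CARD('k)" by (metis distinct_card)
  have bij: "bij_betw ((!) ys) {..<CARD('k)} UNIV"
    using bij_betw_nth [OF ys(2) refl ys(1) [symmetric]] len by (simp add: lessThan_atLeast0)
  define h where "h = the_inv_into {..<CARD('k)} ((!) ys)"
  have h: "bij_betw h UNIV {..<CARD('k)}"
    unfolding h_def using bij by (rule bij_betw_the_inv_into)
  have ys_h: "ys ! h i = i" for i
    unfolding h_def using f_the_inv_into_f_bij_betw [OF bij, of i] by simp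
  \<comment> \<open>\<open>h\<close> gives positions counted from 0, whereas permutation entries
    start at 1.\<close>
  define r :: "real ^ 'k" where "r = (\<chi> i. real (Suc (h i)))"
  have "bij_betw (real \<circ> Suc \<circ> h) UNIV (real ` {1..CARD('k)})"
  proof (rule bij_betw_trans [OF h])
    show "bij_betw (real \<circ> Suc) {..<CARD('k)} (real ` {1..CARD('k)})"
      unfolding bij_betw_def image_comp [symmetric] image_Suc_lessThan
      by (simp add: inj_on_def)
  qed
  moreover have "(\<lambda>i. r $ i) = real \<circ> Suc \<circ> h" by (simp add: r_def fun_eq_iff)
  ultimately have "r \<in> permutation_vectors" by (simp add: permutation_vectors_def)
  moreover have "c $ i \<le> c $ j" if "r $ i < r $ j" for i j
  proof -
    have "h j < length ys" using h len by (auto simp: bij_betw_def)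
    moreover have "h i < h j" using that by (simp add: r_def)
    ultimately show ?thesis
      using sorted_nth_mono [OF ys(3), of "h i" "h j"] by (simp add: ys_h)
  qed
  ultimately show thesis using that by blast
qed

section \<open>Base polytopes\<close>

lemma convex_base_polytope: "convex (base_polytope f)"
proof (rule convexI)
  fix x y and u v :: real
  assume x: "x \<in> base_polytope f" and y: "y \<in> base_polytope f"
    and uv: "0 \<le> u" "0 \<le> v" "u + v = 1"
  have *: "(\<Sum>i\<in>S. (u *\<^sub>R x + v *\<^sub>R y) $ i) = u * (\<Sum>i\<in>S. x $ i) + v * (\<Sum>i\<in>S. y $ i)" for S
    by (simp add: sum.distrib sum_distrib_left)
  have "u * (\<Sum>i\<in>S. x $ i) + v * (\<Sum>i\<in>S. y $ i) \<le> f S" for S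
    by (rule convex_bound_le) (use x y uv in \<open>auto simp: base_polytope_def\<close>)
  moreover have "u * f UNIV + v * f UNIV = f UNIV"
    using uv by (simp flip: distrib_right)
  ultimately show "u *\<^sub>R x + v *\<^sub>R y \<in> base_polytope f"
    unfolding base_polytope_def mem_Collect_eq * using x y by (simp add: base_polytope_def)
qed

lemma finite_permutation_vectors: "finite (permutation_vectors :: (real ^ 'k::finite) set)"
proof (rule finite_subset)
  let ?X = "PiE (UNIV :: 'k set) (\<lambda>_. real ` {1..CARD('k)})"
  show "permutation_vectors \<subseteq> vec_lambda ` ?X"
  proof
    fix x :: "real ^ 'k"
    assume "x \<in> permutation_vectors"
    then have "($) x \<in> ?X" by (auto simp: permutation_vectors_def bij_betw_def)
    then show "x \<in> vec_lambda ` ?X" by (metis image_eqI vec_lambda_eta)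
  qed
  show "finite (vec_lambda ` ?X)" by (intro finite_imageI finite_PiE) auto
qed

text \<open>A point outside the hull would be strictly separated from all greedy vectors,
  contradicting the optimality of one of them.\<close>

lemma base_polytope_eq_convex_hull:
  assumes f: "submodular f" "f {} = 0"
  shows "base_polytope f = convex hull (greedy f ` permutation_vectors)"
    (is "_ = ?H")
proof
  show "?H \<subseteq> base_polytope f"
    by (rule hull_minimal)
      (auto simp: convex_base_polytope greedy_in_base_polytope f inj_permutation_vector)
  show "base_polytope f \<subseteq> ?H"
  proof
    fix x
    assume x: "x \<in> base_polytope f"
    show "x \<in> ?H"
    proof (rule ccontr)
      assume "x \<notin> ?H"
      moreover have "closed ?H"
        by (intro compact_imp_closed finite_imp_compact_convex_hull finite_imageI
            finite_permutation_vectors)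
      ultimately obtain a b where ab: "a \<bullet> x < b" "\<forall>y\<in>?H. b < a \<bullet> y"
        using separating_hyperplane_closed_point [OF convex_convex_hull, of "greedy f ` permutation_vectors" x]
        by blast
      \<comment> \<open>The separating functional \<open>a\<close> is smaller at \<open>x\<close>
        than on the hull, and greedy vectors maximize, so the sorting is by
        \<open>- a\<close>.\<close>
      obtain r where r: "r \<in> permutation_vectors"
        "\<And>i j. r $ i < r $ j \<Longrightarrow> (- a) $ i \<le> (- a) $ j"
        using obtain_sorting_permutation [of "- a"] by blast
      have "(- a) \<bullet> x \<le> (- a) \<bullet> greedy f r"
        by (rule inner_le_greedy) (use f r x inj_permutation_vector in auto)
      moreover have "b < a \<bullet> greedy f r"
        using ab(2) r(1) by (simp add: hull_inc)
      ultimately show False using ab(1) by simp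
    qed
  qed
qed

lemma polytope_base_polytope:
  assumes "submodular f" "f {} = 0"
  shows "polytope (base_polytope f)"
  unfolding base_polytope_eq_convex_hull [OF assms]
  by (intro polytope_convex_hull finite_imageI finite_permutation_vectors)

lemma base_polytope_nonempty:
  assumes "submodular f" "f {} = 0"
  shows "base_polytope f \<noteq> {}"
proof -
  obtain r :: "real ^ 'a" where "r \<in> permutation_vectors"
    using obtain_sorting_permutation [of 0] by blast
  then show ?thesis
    using greedy_in_base_polytope [OF assms inj_permutation_vector] by blast
qed

section \<open>Minkowski sums of base polytopes\<close>

lemma submodular_sum:
  assumes "\<And>i. i \<in> I \<Longrightarrow> submodular (f i)"
  shows "submodular (\<lambda>S. \<Sum>i\<in>I. f i S)"
  unfolding submodular_def
proof (intro allI)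
  fix S T
  show "(\<Sum>i\<in>I. f i (S \<union> T)) + (\<Sum>i\<in>I. f i (S \<inter> T)) \<le> (\<Sum>i\<in>I. f i S) + (\<Sum>i\<in>I. f i T)"
    unfolding sum.distrib [symmetric] by (intro sum_mono submodularD assms)
qed

lemma submodular_add:
  "submodular f \<Longrightarrow> submodular g \<Longrightarrow> submodular (\<lambda>S. f S + g S)"
  using submodular_sum [of "{True, False}" "\<lambda>b. if b then f else g"] by simp

text \<open>Adding the defining inequalities gives only one inclusion. The other needs the vertices:
  for a common order \<open>r\<close> the greedy vector of the sum splits as a sum of greedy
  vectors.\<close>

lemma base_polytope_add:
  assumes f: "submodular f" "f {} = 0" and g: "submodular g" "g {} = 0"
  shows "base_polytope (\<lambda>S. f S + g S) = base_polytope f + base_polytope g"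
proof
  have fg: "submodular (\<lambda>S. f S + g S)" "f {} + g {} = 0"
    using submodular_add [OF f(1) g(1)] f(2) g(2) by simp_all
  have greedy: "greedy (\<lambda>S. f S + g S) r = greedy f r + greedy g r" for r
    by (simp add: greedy_def vec_eq_iff)
  show "base_polytope (\<lambda>S. f S + g S) \<subseteq> base_polytope f + base_polytope g"
    unfolding base_polytope_eq_convex_hull [OF fg]
    by (rule hull_minimal)
      (auto simp: greedy intro!: set_plus_intro convex_set_plus convex_base_polytope
        greedy_in_base_polytope f g inj_permutation_vector)
  show "base_polytope f + base_polytope g \<subseteq> base_polytope (\<lambda>S. f S + g S)"
    by (auto simp: set_plus_def base_polytope_def sum.distrib intro!: add_mono)
qed

lemma base_polytope_zero: "base_polytope (\<lambda>_. 0) = {0}"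
proof -
  have "base_polytope (\<lambda>_. 0 :: real) = convex hull (greedy (\<lambda>_. 0) ` permutation_vectors)"
    by (rule base_polytope_eq_convex_hull) (auto simp: submodular_def)
  moreover have "greedy (\<lambda>_. 0) ` permutation_vectors \<subseteq> {0}"
    by (auto simp: greedy_def vec_eq_iff)
  ultimately show ?thesis
    using base_polytope_nonempty [of "\<lambda>_. 0"]
    by (metis convex_hull_empty convex_hull_singleton image_is_empty submodular_def subset_singletonD order_refl)
qed

lemma base_polytope_sum:
  assumes "finite I" "\<And>i. i \<in> I \<Longrightarrow> submodular (f i)" "\<And>i. i \<in> I \<Longrightarrow> f i {} = 0"
  shows "base_polytope (\<lambda>S. \<Sum>i\<in>I. f i S) = (\<Sum>i\<in>I. base_polytope (f i))"
  using assms
proof (induction I rule: finite_induct)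
  case empty
  then show ?case by (simp add: base_polytope_zero)
next
  case (insert i I)
  have "base_polytope (\<lambda>S. f i S + (\<Sum>i\<in>I. f i S)) =
      base_polytope (f i) + base_polytope (\<lambda>S. \<Sum>i\<in>I. f i S)"
    by (intro base_polytope_add submodular_sum) (use insert.prems in auto)
  with insert show ?case by simp
qed

section \<open>Base polytopes are deformed permutahedra\<close>

text \<open>With k = \<open>card S\<close> and N = \<open>CARD('k)\<close>, this is N + (N - 1) +
  ... + (N - k + 1), the sum of the k largest numbers up to N.\<close>

definition rank_sum :: "'k::finite set \<Rightarrow> real" where
  "rank_sum S = real (card S) * (2 * real CARD('k) + 1 - real (card S)) / 2"

text \<open>The linear part of \<open>rank_sum\<close> is modular and cancels. The quadratic part
  leaves a defect of exactly |S - T| |T - S|, a product of two positive integers.\<close>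

lemma rank_sum_strictly_submodular:
  assumes "\<not> S \<subseteq> T" "\<not> T \<subseteq> S"
  shows "rank_sum (S \<union> T) + rank_sum (S \<inter> T) + 1 \<le> rank_sum S + rank_sum T"
proof -
  define a b i where "a = real (card (S - T))" and "b = real (card (T - S))"
    and "i = real (card (S \<inter> T))"
  have "card (S - T) > 0" "card (T - S) > 0"
    using assms by (auto simp: card_gt_0_iff)
  then have "1 \<le> a" "1 \<le> b" by (auto simp: a_def b_def)
  then have "1 * 1 \<le> a * b" by (intro mult_mono) auto
  moreover have S: "real (card S) = i + a"
    using card_Int_Diff [of S T] by (simp add: a_def i_def)
  moreover have T: "real (card T) = i + b"
    using card_Int_Diff [of T S] by (simp add: b_def i_def Int_commute)
  moreover have "real (card (S \<union> T)) = i + a + b"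
    using arg_cong [OF card_Un_Int [of S T], of real] S T by (simp add: i_def)
  ultimately show ?thesis
    unfolding rank_sum_def i_def [symmetric] by (simp add: field_simps)
qed

lemma submodular_comparable:
  assumes "S \<subseteq> T \<or> T \<subseteq> S"
  shows "f (S \<union> T) + f (S \<inter> T) = f S + (f T :: real)"
  using assms by (auto simp: Un_absorb1 Un_absorb2 Int_absorb1 Int_absorb2)

text \<open>For comparable sets, union and intersection are the two sets themselves, so equality
  holds. This restriction is what lets strict gaps on incomparable sets absorb
  perturbations.\<close>

lemma submodularI:
  assumes "\<And>S T. \<not> S \<subseteq> T \<Longrightarrow> \<not> T \<subseteq> S \<Longrightarrow> f (S \<union> T) + f (S \<inter> T) \<le> f S + f T"
  shows "submodular f"
  unfolding submodular_def
proof (intro allI)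
  fix S T
  show "f (S \<union> T) + f (S \<inter> T) \<le> f S + f T"
    using assms [of S T] submodular_comparable [of S T f] by (cases "S \<subseteq> T \<or> T \<subseteq> S") auto
qed

text \<open>If \<open>r $ i\<close> is k, then N - k + 1 entries are at least k and N - k exceed it.
  The increment of \<open>rank_sum\<close> between these two sizes is k.\<close>

lemma greedy_rank_sum:
  fixes r :: "real ^ 'k::finite"
  assumes "r \<in> permutation_vectors"
  shows "greedy rank_sum r = r"
proof -
  have r: "bij_betw (\<lambda>i. r $ i) UNIV (real ` {1..CARD('k)})"
    using assms by (simp add: permutation_vectors_def)
  have "greedy rank_sum r $ i = r $ i" for i
  proof -
    have range: "range (\<lambda>i. r $ i) = real ` {1..CARD('k)}"
      using r by (simp add: bij_betw_def)
    then have "r $ i \<in> real ` {1..CARD('k)}" by blast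
    then obtain k where k: "1 \<le> k" "k \<le> CARD('k)" "r $ i = real k" by auto
    have "card {j. r $ i \<le> r $ j} = card (($) r ` {j. r $ i \<le> r $ j})"
      using inj_permutation_vector [OF assms] by (metis card_image inj_on_subset subset_UNIV)
    also have "($) r ` {j. r $ i \<le> r $ j} = real ` {k..CARD('k)}"
    proof -
      have "($) r ` {j. r $ i \<le> r $ j} = range (($) r) \<inter> {y. real k \<le> y}"
        by (auto simp: k)
      also have "\<dots> = real ` {k..CARD('k)}"
        unfolding range using k by auto
      finally show ?thesis .
    qed
    also have "card \<dots> = Suc (CARD('k) - k)"
      using k by (simp add: card_image Suc_diff_le)
    finally have le: "card {j. r $ i \<le> r $ j} = Suc (CARD('k) - k)" .
    then have "card {j. r $ i < r $ j} = CARD('k) - k"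
      by (simp add: upper_set_split [OF inj_permutation_vector [OF assms]])
    with le k show ?thesis
      by (simp add: greedy_def rank_sum_def of_nat_diff field_simps)
  qed
  then show ?thesis by (simp add: vec_eq_iff)
qed

lemma submodular_rank_sum: "submodular rank_sum"
proof (rule submodularI)
  fix S T :: "'a set"
  assume "\<not> S \<subseteq> T" "\<not> T \<subseteq> S"
  from rank_sum_strictly_submodular [OF this]
  show "rank_sum (S \<union> T) + rank_sum (S \<inter> T) \<le> rank_sum S + rank_sum T" by linarith
qed

lemma permutahedron_eq_base_polytope:
  "(permutahedron :: (real ^ 'k::finite) set) = base_polytope rank_sum"
proof -
  have "greedy rank_sum ` permutation_vectors = (permutation_vectors :: (real ^ 'k) set)"
    by (simp add: greedy_rank_sum)
  then show ?thesis
    using base_polytope_eq_convex_hull [OF submodular_rank_sum, where ?'a = 'k]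
    unfolding permutahedron_def permutation_vectors_def [symmetric] by (simp add: rank_sum_def)
qed

lemma scale_base_polytope:
  assumes "l > 0"
  shows "(\<lambda>x. l *\<^sub>R x) ` base_polytope f = base_polytope (\<lambda>S. l * f S)"
proof
  show "(\<lambda>x. l *\<^sub>R x) ` base_polytope f \<subseteq> base_polytope (\<lambda>S. l * f S)"
    using assms by (auto simp: base_polytope_def simp flip: sum_distrib_left)
  show "base_polytope (\<lambda>S. l * f S) \<subseteq> (\<lambda>x. l *\<^sub>R x) ` base_polytope f"
  proof
    fix x
    assume "x \<in> base_polytope (\<lambda>S. l * f S)"
    then have "(1 / l) *\<^sub>R x \<in> base_polytope f"
      using assms by (simp add: base_polytope_def field_simps flip: sum_divide_distrib)
    then have "l *\<^sub>R (1 / l) *\<^sub>R x \<in> (\<lambda>x. l *\<^sub>R x) ` base_polytope f" by blast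
    then show "x \<in> (\<lambda>x. l *\<^sub>R x) ` base_polytope f" using assms by simp
  qed
qed

theorem deformed_permutahedron_base_polytope:
  fixes f :: "'k::finite set \<Rightarrow> real"
  assumes f: "submodular f" "f {} = 0"
  shows "deformed_permutahedron (base_polytope f)"
proof -
  define M where "M = (\<Sum>S\<in>UNIV. \<bar>f S\<bar>)"
  have M: "\<bar>f S\<bar> \<le> M" for S
    unfolding M_def by (rule member_le_sum) auto
  then have "0 \<le> M" by (meson abs_ge_zero order_trans)
  \<comment> \<open>Four values of \<open>f\<close>, each at most \<open>M\<close> in absolute
    value, enter a submodularity defect. The extra 1 keeps \<open>l\<close> positive when
    \<open>M\<close> is 0.\<close>
  define l where "l = 4 * M + 1"
  have "l > 0" using \<open>0 \<le> M\<close> by (simp add: l_def)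
  \<comment> \<open>\<open>base_polytope g\<close> will be the complementary Minkowski summand
    \<open>R\<close>.\<close>
  define g where "g = (\<lambda>S. l * rank_sum S - f S)"
  have g: "submodular g"
  proof (rule submodularI)
    fix S T :: "'k set"
    assume "\<not> S \<subseteq> T" "\<not> T \<subseteq> S"
    then have "l * (rank_sum (S \<union> T) + rank_sum (S \<inter> T) + 1) \<le> l * (rank_sum S + rank_sum T)"
      using rank_sum_strictly_submodular \<open>l > 0\<close> by (intro mult_left_mono) auto
    moreover have "f S + f T - f (S \<union> T) - f (S \<inter> T) \<le> l"
      using M [of S] M [of T] M [of "S \<union> T"] M [of "S \<inter> T"] by (simp add: l_def)
    ultimately show "g (S \<union> T) + g (S \<inter> T) \<le> g S + g T"
      by (simp add: g_def algebra_simps)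
  qed
  have g0: "g {} = 0" by (simp add: g_def f rank_sum_def)
  have "(\<lambda>x. l *\<^sub>R x) ` permutahedron = base_polytope (\<lambda>S. f S + g S)"
    by (simp add: permutahedron_eq_base_polytope scale_base_polytope \<open>l > 0\<close> g_def)
  also have "\<dots> = base_polytope f + base_polytope g"
    by (rule base_polytope_add [OF f g g0])
  finally show ?thesis
    unfolding deformed_permutahedron_def deformation_of_def
    using polytope_base_polytope [OF f] polytope_base_polytope [OF g g0]
      base_polytope_nonempty [OF g g0] \<open>l > 0\<close>
      polytope_base_polytope [OF submodular_rank_sum]
    by (auto simp: permutahedron_eq_base_polytope rank_sum_def)
qed

section \<open>The bipartite zonotope\<close>

text \<open>This is the maximum of the coordinate sum over \<open>S\<close> on the segment from
  \<open>axis a 1\<close> to \<open>axis b 1\<close>.\<close>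

definition meets :: "'k \<Rightarrow> 'k \<Rightarrow> 'k set \<Rightarrow> real" where
  "meets a b S = of_bool (a \<in> S \<or> b \<in> S)"

definition incident_arcs :: "('n::finite + 'm::finite) set \<Rightarrow> real" where
  "incident_arcs S = (\<Sum>i\<in>UNIV. \<Sum>j\<in>UNIV. meets (Inl i) (Inr j) S)"

lemma submodular_meets: "submodular (meets a b)"
  by (auto simp: submodular_def meets_def)

lemma submodular_incident_arcs: "submodular incident_arcs"
  unfolding incident_arcs_def [abs_def] by (intro submodular_sum submodular_meets)

lemma base_polytope_meets:
  fixes a b :: "'k::finite"
  assumes "a \<noteq> b"
  shows "base_polytope (meets a b) = closed_segment (axis a 1) (axis b 1)"
proof
  have sum_axis: "(\<Sum>i\<in>S. axis k 1 $ i) = (of_bool (k \<in> S) :: real)" for k :: 'k and S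
    by (simp add: axis_def)
  show "closed_segment (axis a 1) (axis b 1) \<subseteq> base_polytope (meets a b)"
  proof (rule closed_segment_subset)
    show "axis a 1 \<in> base_polytope (meets a b)" "axis b 1 \<in> base_polytope (meets a b)"
      by (simp_all add: base_polytope_def meets_def sum_axis)
  qed (rule convex_base_polytope)
  show "base_polytope (meets a b) \<subseteq> closed_segment (axis a 1) (axis b 1)"
  proof
    fix x
    assume x: "x \<in> base_polytope (meets a b)"
    then have UNIV: "(\<Sum>i\<in>UNIV. x $ i) = 1" and le: "\<And>S. (\<Sum>i\<in>S. x $ i) \<le> meets a b S"
      by (simp_all add: base_polytope_def meets_def)
    \<comment> \<open>Combined with the fixed total, the constraint at a complement
      \<open>UNIV - {k}\<close> becomes a lower bound on \<open>x $ k\<close>.\<close>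
    have split: "(\<Sum>i\<in>UNIV - {k}. x $ i) = 1 - x $ k" for k
      using UNIV by (simp add: sum_diff1)
    have other: "x $ k = 0" if "k \<noteq> a" "k \<noteq> b" for k
      using le [of "{k}"] le [of "UNIV - {k}"] that by (simp add: meets_def split)
    have nonneg: "0 \<le> x $ b" and le1: "x $ b \<le> 1"
      using le [of "{b}"] le [of "UNIV - {b}"] assms by (simp_all add: meets_def split)
    have "(\<Sum>i\<in>UNIV. x $ i) = (\<Sum>i\<in>{a, b}. x $ i)"
      by (rule sum.mono_neutral_right) (use other in auto)
    then have "x $ a = 1 - x $ b" using UNIV assms by simp
    then have "x = (1 - x $ b) *\<^sub>R axis a 1 + x $ b *\<^sub>R axis b 1"
      using other assms by (auto simp: vec_eq_iff axis_def)
    then show "x \<in> closed_segment (axis a 1) (axis b 1)"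
      using nonneg le1 by (auto simp: closed_segment_def)
  qed
qed

lemma bipartite_zonotope_eq_base_polytope: "bipartite_zonotope = base_polytope incident_arcs"
proof -
  have "base_polytope incident_arcs =
      (\<Sum>i\<in>UNIV. base_polytope (\<lambda>S. \<Sum>j\<in>UNIV. meets (Inl i :: 'a + 'b) (Inr j) S))"
    unfolding incident_arcs_def [abs_def]
    by (intro base_polytope_sum submodular_sum submodular_meets) (auto simp: meets_def)
  also have "\<dots> = (\<Sum>i\<in>UNIV. \<Sum>j\<in>UNIV. base_polytope (meets (Inl i :: 'a + 'b) (Inr j)))"
    by (intro sum.cong refl base_polytope_sum submodular_meets) (auto simp: meets_def)
  finally show ?thesis by (simp add: bipartite_zonotope_def base_polytope_meets)
qed

text \<open>The arc joining \<open>Inl i\<close> and \<open>Inr j\<close> meets \<open>S\<close>,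
  \<open>T\<close> and their union but misses the intersection, so it contributes 1 to the defect.
  Every other arc contributes a nonnegative amount.\<close>

lemma incident_arcs_slack:
  assumes i: "Inl i \<in> S" "Inl i \<notin> T" and j: "Inr j \<in> T" "Inr j \<notin> S"
  shows "incident_arcs (S \<union> T) + incident_arcs (S \<inter> T) + 1 \<le> incident_arcs S + incident_arcs T"
proof -
  define d where "d k l = meets (Inl k) (Inr l) S + meets (Inl k) (Inr l) T
      - meets (Inl k) (Inr l) (S \<union> T) - meets (Inl k) (Inr l) (S \<inter> T)" for k l
  have nonneg: "0 \<le> d k l" for k l
    using submodularD [OF submodular_meets, of "Inl k" "Inr l" S T] by (simp add: d_def)
  have "1 = d i j" using i j by (simp add: d_def meets_def)
  also have "\<dots> \<le> (\<Sum>l\<in>UNIV. d i l)"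
    by (rule member_le_sum) (auto simp: nonneg)
  also have "\<dots> \<le> (\<Sum>k\<in>UNIV. \<Sum>l\<in>UNIV. d k l)"
    by (rule member_le_sum [of i UNIV "\<lambda>k. \<Sum>l\<in>UNIV. d k l"]) (auto simp: nonneg sum_nonneg)
  also have "\<dots> = incident_arcs S + incident_arcs T
      - incident_arcs (S \<union> T) - incident_arcs (S \<inter> T)"
    by (simp add: d_def incident_arcs_def sum_subtractf sum.distrib)
  finally show ?thesis by simp
qed

section \<open>Truncations\<close>

definition lower_at :: "'k set \<Rightarrow> ('k set \<Rightarrow> real) \<Rightarrow> 'k set \<Rightarrow> real" where
  "lower_at C f S = f S - of_bool (S = C)"

text \<open>Lowering a value can hurt only on the right-hand side of the inequality. Thus only pairs
  containing \<open>C\<close> need a slack of 1; a union or intersection equal to \<open>C\<close>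
  helps.\<close>

lemma submodular_lower_at:
  fixes C :: "'k set"
  assumes f: "submodular f"
    and C: "\<And>T. \<not> C \<subseteq> T \<Longrightarrow> \<not> T \<subseteq> C \<Longrightarrow> f (C \<union> T) + f (C \<inter> T) + 1 \<le> f C + f T"
  shows "submodular (lower_at C f)"
proof (rule submodularI)
  fix S T :: "'k set"
  assume ST: "\<not> S \<subseteq> T" "\<not> T \<subseteq> S"
  consider "S = C" "T \<noteq> C" | "T = C" "S \<noteq> C" | "S \<noteq> C" "T \<noteq> C"
    using ST by blast
  then show "lower_at C f (S \<union> T) + lower_at C f (S \<inter> T) \<le> lower_at C f S + lower_at C f T"
  proof cases
    case 1
    then show ?thesis using C [of T] ST by (auto simp: lower_at_def)
  next
    case 2
    then show ?thesis using C [of S] ST by (auto simp: lower_at_def Un_commute Int_commute)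
  next
    case 3
    then show ?thesis using submodularD [OF f, of S T] by (auto simp: lower_at_def)
  qed
qed

text \<open>Away from \<open>UNIV\<close>, the lowering tightens one inequality and leaves the
  equation for the total unchanged.\<close>

lemma base_polytope_lower_at:
  assumes "C \<noteq> UNIV"
  shows "base_polytope (lower_at C f) = base_polytope f \<inter> {x. (\<Sum>i\<in>C. x $ i) \<le> f C - 1}"
proof -
  have "(\<forall>S. (\<Sum>i\<in>S. x $ i) \<le> lower_at C f S) \<longleftrightarrow>
      (\<forall>S. (\<Sum>i\<in>S. x $ i) \<le> f S) \<and> (\<Sum>i\<in>C. x $ i) \<le> f C - 1" for x
  proof
    assume *: "\<forall>S. (\<Sum>i\<in>S. x $ i) \<le> lower_at C f S"
    have "lower_at C f S \<le> f S" for S by (simp add: lower_at_def)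
    with * show "(\<forall>S. (\<Sum>i\<in>S. x $ i) \<le> f S) \<and> (\<Sum>i\<in>C. x $ i) \<le> f C - 1"
      using spec [OF *, of C] by (auto simp: lower_at_def intro: order_trans)
  qed (auto simp: lower_at_def)
  then show ?thesis using assms by (auto simp: base_polytope_def lower_at_def)
qed

section \<open>The two sides of the bipartite graph and the truncations at them\<close>

lemma Inl_Inr_range_neq:
  "range Inl \<noteq> (UNIV :: ('n + 'm) set)" "range Inr \<noteq> (UNIV :: ('n + 'm) set)"
  "range Inl \<noteq> (range Inr :: ('n + 'm) set)"
  by blast+

text \<open>Every arc has one end on each side, so either side alone already meets all nm
  arcs.\<close>

lemma incident_arcs_range:
  "incident_arcs (range Inl :: ('n::finite + 'm::finite) set) = real CARD('n) * real CARD('m)"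
  "incident_arcs (range Inr :: ('n::finite + 'm::finite) set) = real CARD('n) * real CARD('m)"
  "incident_arcs (UNIV :: ('n::finite + 'm::finite) set) = real CARD('n) * real CARD('m)"
  "incident_arcs ({} :: ('n::finite + 'm::finite) set) = 0"
  by (simp_all add: incident_arcs_def meets_def)

lemma truncated_zonotope_eq_base_polytope:
  "truncated_zonotope = base_polytope (lower_at (range Inr) incident_arcs)"
  by (simp add: truncated_zonotope_def bipartite_zonotope_eq_base_polytope
      base_polytope_lower_at Inl_Inr_range_neq incident_arcs_range sum.reindex)

text \<open>The first lowering keeps the value nm at \<open>range Inl\<close>, so the second cut is
  again at nm - 1.\<close>

lemma twice_truncated_zonotope_eq_base_polytope:
  "twice_truncated_zonotope =
    base_polytope (lower_at (range Inl) (lower_at (range Inr) incident_arcs))"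
  by (simp add: twice_truncated_zonotope_def truncated_zonotope_eq_base_polytope
      base_polytope_lower_at [of "range Inl"] Inl_Inr_range_neq incident_arcs_range sum.reindex
      lower_at_def [of _ _ "range Inl"])

text \<open>A set incomparable with the side B contains some a_i and misses some b_j, and the arc
  a_i b_j provides the slack.\<close>

lemma submodular_lower_at_Inr:
  "submodular (lower_at (range Inr) (incident_arcs :: ('n::finite + 'm::finite) set \<Rightarrow> real))"
proof (rule submodular_lower_at [OF submodular_incident_arcs])
  fix T :: "('n + 'm) set"
  assume "\<not> range Inr \<subseteq> T" "\<not> T \<subseteq> range Inr"
  then obtain i j where ij: "Inl i \<in> T" "Inr j \<notin> T" by (metis image_subsetI rangeI subsetI sum.exhaust)
  have "Inl i \<notin> (range Inr :: ('n + 'm) set)" by auto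
  with ij show "incident_arcs (range Inr \<union> T) + incident_arcs (range Inr \<inter> T) + 1
      \<le> incident_arcs (range Inr :: ('n + 'm) set) + incident_arcs T"
    using incident_arcs_slack [of i T "range Inr" j] by (auto simp: Un_commute Int_commute add.commute)
qed

text \<open>One arc gives enough slack unless \<open>T\<close> is the side B, whose value has itself
  been lowered; that pair needs a slack of 2.\<close>

lemma submodular_lower_at_Inl_Inr:
  assumes "CARD('n::finite) * CARD('m::finite) \<noteq> 1"
  shows "submodular (lower_at (range Inl)
    (lower_at (range Inr) (incident_arcs :: ('n + 'm) set \<Rightarrow> real)))"
proof (rule submodular_lower_at [OF submodular_lower_at_Inr])
  fix T :: "('n + 'm) set"
  assume T: "\<not> range Inl \<subseteq> T" "\<not> T \<subseteq> range Inl"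
  let ?g = "lower_at (range Inr) (incident_arcs :: ('n + 'm) set \<Rightarrow> real)"
  show "?g (range Inl \<union> T) + ?g (range Inl \<inter> T) + 1 \<le> ?g (range Inl) + ?g T"
  proof (cases "T = range Inr")
    \<comment> \<open>The union is everything and the intersection is empty, so the claim reads nm +
      1 \<le> nm + (nm - 1), that is, 2 \<le> nm. This is where (n, m) = (1, 1) is excluded.\<close>
    case True
    have *: "range Inl \<union> range Inr = (UNIV :: ('n + 'm) set)"
      "range Inl \<inter> range Inr = ({} :: ('n + 'm) set)"
      by (auto simp: UNIV_sum)
    have "0 < CARD('n) * CARD('m)" by simp
    with assms have "2 \<le> CARD('n) * CARD('m)" by linarith
    then have "2 \<le> real CARD('n) * real CARD('m)" by (metis of_nat_mult of_nat_le_iff of_nat_numeral)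
    moreover have "?g UNIV = real CARD('n) * real CARD('m)" "?g {} = 0"
      "?g (range Inl) = real CARD('n) * real CARD('m)"
      "?g (range Inr) = real CARD('n) * real CARD('m) - 1"
      using Inl_Inr_range_neq [where ?'n = 'n and ?'m = 'm, THEN not_sym]
        Inl_Inr_range_neq [where ?'n = 'n and ?'m = 'm]
      by (simp_all add: lower_at_def incident_arcs_range)
    ultimately show ?thesis unfolding True * by linarith
  next
    case False
    obtain i j where "Inl i \<notin> T" "Inr j \<in> T"
      using T by (metis image_subsetI rangeI subsetI sum.exhaust)
    moreover have "Inr j \<notin> (range Inl :: ('n + 'm) set)" by auto
    ultimately have "incident_arcs (range Inl \<union> T) + incident_arcs (range Inl \<inter> T) + 1
        \<le> incident_arcs (range Inl :: ('n + 'm) set) + incident_arcs T"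
      by (intro incident_arcs_slack [of i _ _ j]) auto
    \<comment> \<open>The first lowering leaves both right-hand values unchanged and can only
      decrease the left-hand ones, so the slack of \<open>incident_arcs\<close> carries
      over.\<close>
    moreover have "?g S \<le> incident_arcs S" for S by (simp add: lower_at_def)
    then have "?g (range Inl \<union> T) \<le> incident_arcs (range Inl \<union> T)"
      "?g (range Inl \<inter> T) \<le> incident_arcs (range Inl \<inter> T)" by blast+
    moreover have "?g T = incident_arcs T"
      "?g (range Inl) = incident_arcs (range Inl :: ('n + 'm) set)"
      using False Inl_Inr_range_neq(3) [where ?'n = 'n and ?'m = 'm] by (simp_all add: lower_at_def)
    ultimately show ?thesis by linarith
  qed
qed

theorem theorem3p3p7:
  assumes "(CARD('n::finite), CARD('m::finite)) \<noteq> (1, 1)"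
  shows "deformed_permutahedron (truncated_zonotope :: (real ^ ('n + 'm)) set) \<and>
    deformed_permutahedron (twice_truncated_zonotope :: (real ^ ('n + 'm)) set)"
proof
  have nm: "CARD('n) * CARD('m) \<noteq> 1" using assms by simp
  have empty: "lower_at (range Inr) incident_arcs ({} :: ('n + 'm) set) = 0"
    "lower_at (range Inl) (lower_at (range Inr) incident_arcs) ({} :: ('n + 'm) set) = 0"
    by (auto simp: lower_at_def incident_arcs_range)
  show "deformed_permutahedron (truncated_zonotope :: (real ^ ('n + 'm)) set)"
    unfolding truncated_zonotope_eq_base_polytope
    by (rule deformed_permutahedron_base_polytope [OF submodular_lower_at_Inr empty(1)])
  show "deformed_permutahedron (twice_truncated_zonotope :: (real ^ ('n + 'm)) set)"
    unfolding twice_truncated_zonotope_eq_base_polytope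
    by (rule deformed_permutahedron_base_polytope [OF submodular_lower_at_Inl_Inr [OF nm] empty(2)])
qed

end
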